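(* Let $H \ge 2$ be a real number and let three squares with pairwise disjoint interiors lie inside the rectangle $R = [0,1] \times [0,H] \subset \mathbb{R}^2$. The squares may be arbitrarily rotated. Then the sum of their side lengths is at most $H$.
   Context: A square means a closed solid (filled) square in the Euclidean plane $\mathbb{R}^2$, of arbitrary orientation (not necessarily axis-parallel). The three squares may have different side lengths and different orientations. *)

theory Defs
  imports "HOL-Analysis.Analysis"
begin

text \<open>
  The closed solid square with side length \<open>s\<close> and arbitrary orientation: \<open>p\<close> is a corner,
  and the orthonormal vectors \<open>u\<close>, \<open>v\<close> point along the two sides meeting there.
  The norm and inner product on \<^typ>\<open>real \<times> real\<close> are the Euclidean ones.
\<close>

definition is_square :: "(real \<times> real) set \<Rightarrow> real \<Rightarrow> bool" where
  "is_square Q s \<longleftrightarrow> s > 0 \<and>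
    (\<exists>p u v. norm u = 1 \<and> norm v = 1 \<and> inner u v = 0 \<and>
      Q = {p + a *\<^sub>R u + b *\<^sub>R v | a b. a \<in> {0..s} \<and> b \<in> {0..s}})"

end

theory Submission
  imports Defs
begin

text \<open>
  If two of the squares are separated by a vertical line, their sides add up to at most the width
  \<open>1\<close>, and the third side is at most \<open>1\<close> too, so the sum is at most \<open>2 \<le> H\<close>. Otherwise
  every pair is separated by a non-vertical line, one square being below and the other above. A
  tournament on three vertices has a Hamiltonian path, so the squares can be named such that the
  first is below the second and the second below the third. Such a chain already forces the bound.

  Let \<open>y + t x = a\<close> and \<open>y + r x = b\<close> be the two separating lines. The bottom square lies in a
  corner of the strip cut off by the first line, and in such a corner no square is larger than the
  axis-parallel one that fills the right angle
  (\<open>corner_inequality\<close>). This bounds the bottom side in terms of \<open>t\<close> and \<open>a\<close>,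
  and the top side in terms of \<open>r\<close> and \<open>b\<close> likewise. The middle square keeps the two
  lines apart: its support in the two normal directions bounds \<open>b - a\<close> from below, up to a term in the
  abscissa of its centre, which its width controls. The same corner inequality, now applied to
  the angle between the middle square and the steeper line, shows that the three bounds add up to at most
  \<open>H\<close> (\<open>chain_arithmetic\<close>).
\<close>

section \<open>Support of a square\<close>

text \<open>
  What is used below of a square with centre \<open>(x, y)\<close> and a unit vector \<open>(C, S)\<close> along a side:
  \<open>s / 2 * (\<bar>\<alpha> * C + \<beta> * S\<bar> + \<bar>\<alpha> * S - \<beta> * C\<bar>)\<close> is how far it extends from its centre in
  direction \<open>(\<alpha>, \<beta>)\<close>, and a half-plane that contains the square leaves room for this extent.
\<close>

definition posed :: "(real \<times> real) set \<Rightarrow> real \<Rightarrow> real \<Rightarrow> real \<Rightarrow> real \<Rightarrow> real \<Rightarrow> bool" where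
  "posed Q s x y C S \<longleftrightarrow> C\<^sup>2 + S\<^sup>2 = 1 \<and>
    (\<forall>\<alpha> \<beta> c. (\<forall>(x, y) \<in> Q. \<alpha> * x + \<beta> * y \<le> c) \<longrightarrow>
      \<alpha> * x + \<beta> * y + s / 2 * (\<bar>\<alpha> * C + \<beta> * S\<bar> + \<bar>\<alpha> * S - \<beta> * C\<bar>) \<le> c)"

lemma posed_unit: "posed Q s x y C S \<Longrightarrow> C\<^sup>2 + S\<^sup>2 = 1"
  by (simp add: posed_def)

lemma posed_support:
  assumes "posed Q s x y C S" "\<And>x y. (x, y) \<in> Q \<Longrightarrow> \<alpha> * x + \<beta> * y \<le> c"
  shows "\<alpha> * x + \<beta> * y + s / 2 * (\<bar>\<alpha> * C + \<beta> * S\<bar> + \<bar>\<alpha> * S - \<beta> * C\<bar>) \<le> c"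
proof -
  have "\<forall>(x, y) \<in> Q. \<alpha> * x + \<beta> * y \<le> c" using assms(2) by blast
  then show ?thesis using assms(1) unfolding posed_def by blast
qed

lemma square_posed:
  assumes "is_square Q s"
  obtains x y C S where "posed Q s x y C S"
proof -
  obtain p u v where "s > 0" and "norm u = 1" "norm v = 1" "inner u v = 0"
    and Q: "Q = {p + a *\<^sub>R u + b *\<^sub>R v | a b. a \<in> {0..s} \<and> b \<in> {0..s}}"
    using assms unfolding is_square_def by blast
  obtain p1 p2 C S v1 v2 where eqs: "p = (p1, p2)" "u = (C, S)" "v = (v1, v2)"
    by (metis prod.exhaust)
  have CS: "C\<^sup>2 + S\<^sup>2 = 1" and V: "v1\<^sup>2 + v2\<^sup>2 = 1" and CV: "C * v1 + S * v2 = 0"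
    using \<open>norm u = 1\<close> \<open>norm v = 1\<close> \<open>inner u v = 0\<close> by (auto simp: eqs norm_Pair inner_Pair)
  \<comment> \<open>In the plane \<open>v\<close> is \<open>u\<close> turned by a right angle, up to the sign \<open>k\<close>.\<close>
  define k where "k = C * v2 - S * v1"
  have v1: "v1 = - (k * S)" and v2: "v2 = k * C" and "k\<^sup>2 = 1"
    unfolding k_def using CS V CV by algebra+
  then have k: "\<bar>k\<bar> = 1" by (auto simp: power2_eq_1_iff)
  show thesis
  proof (rule that, unfold posed_def, intro conjI allI impI)
    show "C\<^sup>2 + S\<^sup>2 = 1" by (rule CS)
  next
    fix \<alpha> \<beta> c assume le: "\<forall>(x, y) \<in> Q. \<alpha> * x + \<beta> * y \<le> c"
    define A where "A = \<alpha> * C + \<beta> * S"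
    define B where "B = \<alpha> * v1 + \<beta> * v2"
    \<comment> \<open>The corner of the square that is extreme in direction \<open>(\<alpha>, \<beta>)\<close>.\<close>
    define a where "a = (if A \<ge> 0 then s else 0)"
    define b where "b = (if B \<ge> 0 then s else 0)"
    have "(p1 + a * C + b * v1, p2 + a * S + b * v2) \<in> Q"
      using \<open>s > 0\<close> unfolding Q
      by (intro CollectI exI[of _ a] exI[of _ b]) (auto simp: eqs a_def b_def)
    then have "\<alpha> * (p1 + a * C + b * v1) + \<beta> * (p2 + a * S + b * v2) \<le> c"
      using le by blast
    then have "\<alpha> * p1 + \<beta> * p2 + a * A + b * B \<le> c"
      by (simp add: A_def B_def algebra_simps)
    moreover have "a * A = s / 2 * (A + \<bar>A\<bar>)" "b * B = s / 2 * (B + \<bar>B\<bar>)"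
      by (auto simp: a_def b_def)
    moreover have "\<bar>B\<bar> = \<bar>\<alpha> * S - \<beta> * C\<bar>"
    proof -
      have "B = - (k * (\<alpha> * S - \<beta> * C))" by (simp add: B_def v1 v2 algebra_simps)
      then show ?thesis using k by (simp add: abs_mult)
    qed
    ultimately show "\<alpha> * (p1 + s / 2 * (C + v1)) + \<beta> * (p2 + s / 2 * (S + v2))
        + s / 2 * (\<bar>\<alpha> * C + \<beta> * S\<bar> + \<bar>\<alpha> * S - \<beta> * C\<bar>) \<le> c"
      by (simp add: A_def B_def field_simps)
  qed
qed

lemma one_le_sum_abs_unit:
  fixes C S :: real
  assumes "C\<^sup>2 + S\<^sup>2 = 1"
  shows "1 \<le> \<bar>C\<bar> + \<bar>S\<bar>"
proof -
  have "1\<^sup>2 \<le> (\<bar>C\<bar> + \<bar>S\<bar>)\<^sup>2" using assms by (simp add: power2_sum)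
  then show ?thesis by (rule power2_le_imp_le) simp
qed

lemma square_side_le_horizontal_extent:
  assumes "is_square Q s" "\<And>x y. (x, y) \<in> Q \<Longrightarrow> l \<le> x \<and> x \<le> h"
  shows "s \<le> h - l"
proof -
  have "s > 0" using assms by (simp add: is_square_def)
  obtain x y C S where pose: "posed Q s x y C S"
    using square_posed[OF assms(1)] .
  note CS = posed_unit[OF pose] and * = posed_support[OF pose]
  have "s * 1 \<le> s * (\<bar>C\<bar> + \<bar>S\<bar>)"
    using one_le_sum_abs_unit[OF CS] \<open>s > 0\<close> by (intro mult_left_mono) auto
  moreover have "x + s / 2 * (\<bar>C\<bar> + \<bar>S\<bar>) \<le> h" using *[of 1 0 h] assms(2) by simp
  moreover have "- x + s / 2 * (\<bar>C\<bar> + \<bar>S\<bar>) \<le> - l" using *[of "-1" 0 "- l"] assms(2) by simp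
  ultimately show ?thesis by (simp add: field_simps)
qed

corollary square_side_le_one:
  assumes "is_square Q s" "Q \<subseteq> {0..1} \<times> X"
  shows "s \<le> 1"
  using square_side_le_horizontal_extent[OF assms(1), of 0 1] assms(2) by force

section \<open>Squares in a corner\<close>

text \<open>
  Up to the factor \<open>s / 2\<close>, the right-hand side is the least value that the maximum of \<open>x + r y\<close>
  can take on a square of side \<open>s\<close> with this orientation in the first quadrant: the first summand
  comes from the position of the centre, the second from the extent beyond it. The left-hand side is
  that value for the axis-parallel square at the origin. Whichever sign \<open>r * c - d\<close> has, where \<open>c\<close>
  and \<open>d\<close> are the absolute values of \<open>C\<close> and \<open>S\<close> in some order, the inequality follows from
  \<open>(1 - c) * (1 - d) \<ge> 0\<close>.
\<close>

lemma corner_inequality: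
  fixes C S r :: real
  assumes CS: "C\<^sup>2 + S\<^sup>2 = 1" and "r \<ge> 0"
  shows "2 + 2 * r \<le> (1 + r) * (\<bar>C\<bar> + \<bar>S\<bar>) + (\<bar>C + r * S\<bar> + \<bar>r * C - S\<bar>)"
proof -
  have main: "2 + 2 * r \<le> (1 + r) * (c + d) + ((c + r * d) + \<bar>r * c - d\<bar>)"
    if "c \<ge> 0" "d \<ge> 0" "c\<^sup>2 + d\<^sup>2 = 1" for c d :: real
  proof -
    have "c\<^sup>2 \<le> 1\<^sup>2" "d\<^sup>2 \<le> 1\<^sup>2"
      using that(3) zero_le_power2[of c] zero_le_power2[of d] unfolding one_power2 by linarith+
    then have "c \<le> 1" "d \<le> 1"
      using power2_le_imp_le[of c 1] power2_le_imp_le[of d 1] by simp_all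
    then have prod: "(1 - c) * (1 - d) \<ge> 0" by simp
    have sum: "c + d \<ge> 1" using one_le_sum_abs_unit[OF that(3)] that by simp
    show ?thesis
    proof (cases "d \<le> r * c")
      case d: True
      have "0 \<le> c + r * (c + d) - 1 - r"
      proof (cases "c = 0")
        case True
        then show ?thesis using d that by simp
      next
        case False
        have "d * (c + d - 1) \<le> (r * c) * (c + d - 1)"
          using d sum by (intro mult_right_mono) auto
        moreover have "d * (c + d - 1) - c * (1 - c) = (1 - c) * (1 - d)"
          using that(3) by algebra
        ultimately have "0 \<le> c * (c + r * (c + d) - 1 - r)"
          using prod by (simp add: algebra_simps)
        then show ?thesis using False that(1) by (simp add: zero_le_mult_iff)
      qed
      then show ?thesis using d by (simp add: algebra_simps)
    next
      case False
      have "0 \<le> c + d - 1 - r * (1 - d)"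
      proof (cases "c = 0")
        case True
        then show ?thesis using that by (simp add: power2_eq_1_iff)
      next
        case c: False
        have "(r * c) * (1 - d) \<le> d * (1 - d)"
          using False \<open>d \<le> 1\<close> by (intro mult_right_mono) auto
        moreover have "c * (c + d - 1) - d * (1 - d) = (1 - c) * (1 - d)"
          using that(3) by algebra
        ultimately have "0 \<le> c * (c + d - 1 - r * (1 - d))"
          using prod by (simp add: algebra_simps)
        then show ?thesis using c that(1) by (simp add: zero_le_mult_iff)
      qed
      then show ?thesis using False by (simp add: algebra_simps)
    qed
  qed
  show ?thesis
  proof (cases "C * S \<ge> 0")
    case True
    then consider "C \<ge> 0" "S \<ge> 0" | "C \<le> 0" "S \<le> 0" by (auto simp: zero_le_mult_iff)
    then have "\<bar>C + r * S\<bar> = \<bar>C\<bar> + r * \<bar>S\<bar> \<and> \<bar>r * C - S\<bar> = \<bar>r * \<bar>C\<bar> - \<bar>S\<bar>\<bar>"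
    proof cases
      case 1
      then show ?thesis using mult_nonneg_nonneg[OF \<open>r \<ge> 0\<close> 1(2)] by simp
    next
      case 2
      then show ?thesis using mult_nonneg_nonpos[OF \<open>r \<ge> 0\<close> 2(2)] by simp
    qed
    then show ?thesis using main[of "\<bar>C\<bar>" "\<bar>S\<bar>"] CS by simp
  next
    case False
    then consider "C \<ge> 0" "S \<le> 0" | "C \<le> 0" "S \<ge> 0" by (fastforce simp: zero_le_mult_iff)
    then have "\<bar>r * C - S\<bar> = \<bar>S\<bar> + r * \<bar>C\<bar> \<and> \<bar>C + r * S\<bar> = \<bar>r * \<bar>S\<bar> - \<bar>C\<bar>\<bar>"
    proof cases
      case 1
      then show ?thesis using mult_nonneg_nonneg[OF \<open>r \<ge> 0\<close> 1(1)] by simp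
    next
      case 2
      then show ?thesis using mult_nonneg_nonpos[OF \<open>r \<ge> 0\<close> 2(1)] by simp
    qed
    then show ?thesis using main[of "\<bar>S\<bar>" "\<bar>C\<bar>"] CS by (simp add: add.commute)
  qed
qed

lemma corner_inequality_abs:
  fixes C S r :: real
  assumes CS: "C\<^sup>2 + S\<^sup>2 = 1"
  shows "2 + 2 * \<bar>r\<bar> \<le> (1 + \<bar>r\<bar>) * (\<bar>C\<bar> + \<bar>S\<bar>) + (\<bar>r * C + S\<bar> + \<bar>r * S - C\<bar>)"
proof (cases "r \<ge> 0")
  case True
  then show ?thesis using corner_inequality[of C "- S" r] CS by (simp add: abs_minus_commute)
next
  case False
  have "\<bar>r * C + S\<bar> = \<bar>- r * C - S\<bar>" "\<bar>r * S - C\<bar> = \<bar>C + - r * S\<bar>" by linarith+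
  then show ?thesis using False corner_inequality[of C S "- r"] CS by simp
qed

text \<open>
  The line \<open>y + t x = a\<close> cuts off the corner \<open>(0, 0)\<close> of the half-strip if \<open>t \<ge> 0\<close> and the corner
  \<open>(1, 0)\<close>, where \<open>y + t x\<close> has the value \<open>t\<close>, if \<open>t \<le> 0\<close>. The sign \<open>e\<close> and the offset \<open>h\<close> let
  the half-strip open upwards or downwards, for the bottom and the top square of a chain.
\<close>

lemma square_in_corner_bound:
  fixes e h :: real
  assumes "is_square Q s" and e: "e = 1 \<or> e = - 1"
    and box: "\<And>x y. (x, y) \<in> Q \<Longrightarrow> 0 \<le> x \<and> x \<le> 1 \<and> 0 \<le> e * y + h"
    and line: "\<And>x y. (x, y) \<in> Q \<Longrightarrow> e * y + t * x \<le> a"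
  shows "s * (1 + \<bar>t\<bar>) \<le> a + h + max 0 (- t)"
proof -
  have "s > 0" using assms by (simp add: is_square_def)
  obtain x y C S where pose: "posed Q s x y C S"
    using square_posed[OF assms(1)] .
  note CS = posed_unit[OF pose] and * = posed_support[OF pose]
  define g where "g = \<bar>C\<bar> + \<bar>S\<bar>"
  define G where "G = \<bar>t * C + e * S\<bar> + \<bar>t * S - e * C\<bar>"
  have "0 * x + (- e) * y + s / 2 * (\<bar>0 * C + (- e) * S\<bar> + \<bar>0 * S - (- e) * C\<bar>) \<le> h"
    by (rule *) (use box in force)
  then have y: "s / 2 * g \<le> e * y + h" using e by (auto simp: g_def add.commute)
  have x0: "s / 2 * g \<le> x" using *[of "-1" 0 0] box by (simp add: g_def)
  have x1: "s / 2 * g \<le> 1 - x" using *[of 1 0 1] box by (simp add: g_def)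
  have top: "e * y + t * x + s / 2 * G \<le> a"
    using *[of t e a] line by (simp add: G_def algebra_simps)
  have "\<bar>t\<bar> * (s / 2 * g) \<le> t * x + max 0 (- t)"
    using mult_left_mono[OF x0, of t] mult_left_mono[OF x1, of "- t"]
    by (cases "t \<ge> 0") (auto simp: algebra_simps)
  then have "s / 2 * ((1 + \<bar>t\<bar>) * g + G) \<le> a + h + max 0 (- t)"
    using y top by (simp add: algebra_simps)
  moreover have "2 + 2 * \<bar>t\<bar> \<le> (1 + \<bar>t\<bar>) * g + G"
    using e
  proof
    assume "e = 1"
    then show ?thesis using corner_inequality_abs[OF CS, of t] by (simp add: g_def G_def)
  next
    assume "e = - 1"
    then have "G = \<bar>t * - C + S\<bar> + \<bar>t * S - - C\<bar>" unfolding G_def by simp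
    then show ?thesis using corner_inequality_abs[of "- C" S t] CS by (simp add: g_def)
  qed
  then have "s / 2 * (2 + 2 * \<bar>t\<bar>) \<le> s / 2 * ((1 + \<bar>t\<bar>) * g + G)"
    using \<open>s > 0\<close> by (intro mult_left_mono) auto
  ultimately show ?thesis by (simp add: algebra_simps)
qed

section \<open>Chains of three squares\<close>

text \<open>
  Here \<open>g\<close>, \<open>G\<close> and \<open>K\<close> stand for the extents of the middle square, relative to \<open>s2 / 2\<close>, in the
  directions \<open>(1, 0)\<close>, \<open>(t, 1)\<close> and \<open>(r, 1)\<close>, and \<open>(x, y)\<close> for its centre.
  The bounds on the outer squares are weighted by \<open>1 + \<bar>t\<bar>\<close> and \<open>1 + r\<close>. The weights are
  made equal by adding \<open>s1 \<le> 1\<close> with the factor \<open>r - \<bar>t\<bar>\<close>, and this is why the line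
  with \<open>r\<close> is taken to be the steeper one. For that line \<open>K\<close> is bounded by
  \<open>corner_inequality\<close>; for the other one the triangle inequality
  \<open>(1 - \<bar>t\<bar>) * g \<le> G\<close> suffices. The slack that remains is at least a nonnegative multiple of
  \<open>1 - s2 * g\<close>, which is nonnegative because the middle square fits into the width \<open>1\<close>.
\<close>

lemma chain_arithmetic_steeper:
  fixes t r :: real
  assumes H: "H \<ge> 2" and tr: "\<bar>t\<bar> \<le> r" and "s2 > 0" and s1: "s1 \<le> 1"
    and bottom: "s1 * (1 + \<bar>t\<bar>) \<le> a + max 0 (- t)"
    and top: "s3 * (1 + r) \<le> H - b + r"
    and m1: "a + s2 / 2 * G \<le> y + t * x" and m2: "y + r * x + s2 / 2 * K \<le> b"
    and x0: "s2 / 2 * g \<le> x" and x1: "x \<le> 1 - s2 / 2 * g"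
    and G: "(1 - \<bar>t\<bar>) * g \<le> G" and K: "2 + 2 * r \<le> (1 + r) * g + K"
  shows "s1 + s2 + s3 \<le> H"
proof -
  have r: "r \<ge> 0" using tr by linarith
  have e1: "(r - \<bar>t\<bar>) * s1 \<le> r - \<bar>t\<bar>" using tr s1 by (simp add: mult_left_le)
  have e2: "(r - t) * (s2 / 2 * g) \<le> (r - t) * x" using x0 tr by (intro mult_left_mono) auto
  have e3: "s2 / 2 * (2 + 2 * r - (\<bar>t\<bar> + r) * g) \<le> s2 / 2 * (G + K)"
    using G K \<open>s2 > 0\<close> by (intro mult_left_mono) (auto simp: algebra_simps)
  have e4: "max 0 t * (s2 * g) \<le> max 0 t" using x0 x1 by (intro mult_left_le) auto
  have e5: "2 * r \<le> H * r" using H r by (rule mult_right_mono)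
  have e6: "max 0 (- t) = \<bar>t\<bar> - max 0 t" "t = 2 * max 0 t - \<bar>t\<bar>" by auto
  have "(1 + r) * (s1 + s3) \<le> H + max 0 (- t) + 2 * r - \<bar>t\<bar> - (r - t) * x - s2 / 2 * (G + K)"
  proof -
    have "(1 + r) * (s1 + s3) = s1 * (1 + \<bar>t\<bar>) + (r - \<bar>t\<bar>) * s1 + s3 * (1 + r)"
      by (simp add: algebra_simps)
    moreover have "(r - t) * x = r * x - t * x" "s2 / 2 * (G + K) = s2 / 2 * G + s2 / 2 * K"
      by (simp_all add: algebra_simps)
    ultimately show ?thesis using e1 bottom top m1 m2 by linarith
  qed
  also have "\<dots> \<le> H + 2 * r - max 0 t - (r - t) * (s2 / 2 * g)
      - s2 / 2 * (2 + 2 * r - (\<bar>t\<bar> + r) * g)"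
    using e2 e3 e6(1) by linarith
  also have "\<dots> = H + 2 * r - max 0 t + max 0 t * (s2 * g) - (1 + r) * s2"
    by (subst (2) e6(2)) (simp add: field_simps)
  also have "\<dots> \<le> H + H * r - (1 + r) * s2" using e4 e5 by linarith
  finally have "(1 + r) * (s1 + s2 + s3) \<le> (1 + r) * H" by (simp add: algebra_simps)
  then show ?thesis using r by simp
qed

text \<open>
  The symmetries of the strip reduce the general case to the previous one: \<open>x \<mapsto> 1 - x\<close> negates both
  slopes, and \<open>y \<mapsto> H - y\<close> exchanges the outer squares together with the two lines.
\<close>

lemma chain_arithmetic:
  fixes t r :: real
  assumes H: "H \<ge> 2" and "s2 > 0" and "s1 \<le> 1" "s3 \<le> 1"
    and bottom: "s1 * (1 + \<bar>t\<bar>) \<le> a + max 0 (- t)"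
    and top: "s3 * (1 + \<bar>r\<bar>) \<le> H - b + max 0 r"
    and m1: "a + s2 / 2 * G \<le> y + t * x" and m2: "y + r * x + s2 / 2 * K \<le> b"
    and x: "s2 / 2 * g \<le> x" "x \<le> 1 - s2 / 2 * g"
    and G: "(1 - \<bar>t\<bar>) * g \<le> G" "2 + 2 * \<bar>t\<bar> \<le> (1 + \<bar>t\<bar>) * g + G"
    and K: "(1 - \<bar>r\<bar>) * g \<le> K" "2 + 2 * \<bar>r\<bar> \<le> (1 + \<bar>r\<bar>) * g + K"
  shows "s1 + s2 + s3 \<le> H"
proof -
  have x': "s2 / 2 * g \<le> 1 - x" "1 - x \<le> 1 - s2 / 2 * g" using x by auto
  consider "\<bar>t\<bar> \<le> r" | "\<bar>t\<bar> \<le> - r" | "\<bar>r\<bar> \<le> - t" | "\<bar>r\<bar> \<le> t" by linarith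
  then show ?thesis
  proof cases
    case 1
    then have r: "\<bar>r\<bar> = r" "max 0 r = r" by auto
    show ?thesis
      by (rule chain_arithmetic_steeper[OF H 1 \<open>s2 > 0\<close> \<open>s1 \<le> 1\<close> bottom top[unfolded r]
            m1 m2 x G(1) K(2)[unfolded r]])
  next
    case 2
    then have r: "\<bar>r\<bar> = - r" "max 0 r = 0" by auto
    have t: "\<bar>- t\<bar> \<le> - r" using 2 by simp
    have bottom': "s1 * (1 + \<bar>- t\<bar>) \<le> a - t + max 0 (- (- t))"
      using bottom by (cases "t \<ge> 0") auto
    have top': "s3 * (1 + - r) \<le> H - (b - r) + - r"
      using top unfolding r by simp
    have m1': "a - t + s2 / 2 * G \<le> y + - t * (1 - x)"
      and m2': "y + - r * (1 - x) + s2 / 2 * K \<le> b - r"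
      using m1 m2 by (simp_all add: algebra_simps)
    have G': "(1 - \<bar>- t\<bar>) * g \<le> G" using G(1) by simp
    show ?thesis
      by (rule chain_arithmetic_steeper[OF H t \<open>s2 > 0\<close> \<open>s1 \<le> 1\<close> bottom' top' m1' m2' x' G'
            K(2)[unfolded r]])
  next
    case 3
    then have t: "\<bar>t\<bar> = - t" "max 0 (- t) = - t" by auto
    have r: "\<bar>- r\<bar> \<le> - t" using 3 by simp
    have top': "s3 * (1 + \<bar>- r\<bar>) \<le> H - b + max 0 (- (- r))" using top by simp
    have bottom': "s1 * (1 + - t) \<le> H - (H - a) + - t" using bottom unfolding t by simp
    have m1': "H - b + s2 / 2 * K \<le> H - y + - r * x"
      and m2': "H - y + - t * x + s2 / 2 * G \<le> H - a"
      using m1 m2 by (simp_all add: algebra_simps)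
    have K': "(1 - \<bar>- r\<bar>) * g \<le> K" using K(1) by simp
    have "s3 + s2 + s1 \<le> H"
      by (rule chain_arithmetic_steeper[OF H r \<open>s2 > 0\<close> \<open>s3 \<le> 1\<close> top' bottom' m1' m2' x K'
            G(2)[unfolded t]])
    then show ?thesis by simp
  next
    case 4
    then have t: "\<bar>t\<bar> = t" "max 0 (- t) = 0" by auto
    have top': "s3 * (1 + \<bar>r\<bar>) \<le> H - b + r + max 0 (- r)"
      using top by (cases "r \<ge> 0") auto
    have bottom': "s1 * (1 + t) \<le> H - (H - a + t) + t" using bottom unfolding t by simp
    have m1': "H - b + r + s2 / 2 * K \<le> H - y + r * (1 - x)"
      and m2': "H - y + t * (1 - x) + s2 / 2 * G \<le> H - a + t"
      using m1 m2 by (simp_all add: algebra_simps)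
    have "s3 + s2 + s1 \<le> H"
      by (rule chain_arithmetic_steeper[OF H 4 \<open>s2 > 0\<close> \<open>s3 \<le> 1\<close> top' bottom' m1' m2' x' K(1)
            G(2)[unfolded t]])
    then show ?thesis by simp
  qed
qed

definition lies_below :: "(real \<times> real) set \<Rightarrow> (real \<times> real) set \<Rightarrow> bool" where
  "lies_below P Q \<longleftrightarrow>
    (\<exists>t a. (\<forall>(x, y) \<in> P. y + t * x \<le> a) \<and> (\<forall>(x, y) \<in> Q. a \<le> y + t * x))"

lemma chain_sum_le:
  assumes "H \<ge> 2"
    and sq: "is_square Q1 s1" "is_square Q2 s2" "is_square Q3 s3"
    and box: "Q1 \<subseteq> {0..1} \<times> {0..H}" "Q2 \<subseteq> {0..1} \<times> {0..H}" "Q3 \<subseteq> {0..1} \<times> {0..H}"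
    and "lies_below Q1 Q2" "lies_below Q2 Q3"
  shows "s1 + s2 + s3 \<le> H"
proof -
  have "s2 > 0" using sq by (simp add: is_square_def)
  obtain t a where Q1: "\<And>x y. (x, y) \<in> Q1 \<Longrightarrow> y + t * x \<le> a"
    and Q2a: "\<And>x y. (x, y) \<in> Q2 \<Longrightarrow> a \<le> y + t * x"
    using \<open>lies_below Q1 Q2\<close> unfolding lies_below_def by blast
  obtain r b where Q2b: "\<And>x y. (x, y) \<in> Q2 \<Longrightarrow> y + r * x \<le> b"
    and Q3: "\<And>x y. (x, y) \<in> Q3 \<Longrightarrow> b \<le> y + r * x"
    using \<open>lies_below Q2 Q3\<close> unfolding lies_below_def by blast
  have s1: "s1 \<le> 1" and s3: "s3 \<le> 1"
    using sq box by (auto intro: square_side_le_one)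
  have bottom: "s1 * (1 + \<bar>t\<bar>) \<le> a + max 0 (- t)"
    using square_in_corner_bound[OF sq(1), of 1 0 t a] box Q1 by force
  have top: "s3 * (1 + \<bar>r\<bar>) \<le> H - b + max 0 r"
    using square_in_corner_bound[OF sq(3), of "- 1" H "- r" "- b"] box Q3 by force
  obtain x y C S where pose: "posed Q2 s2 x y C S"
    using square_posed[OF sq(2)] .
  note CS = posed_unit[OF pose] and * = posed_support[OF pose]
  define g where "g = \<bar>C\<bar> + \<bar>S\<bar>"
  define G where "G t = \<bar>t * C + S\<bar> + \<bar>t * S - C\<bar>" for t
  have x0: "s2 / 2 * g \<le> x" using *[of "-1" 0 0] box by (force simp: g_def)
  have x1: "x \<le> 1 - s2 / 2 * g" using *[of 1 0 1] box by (force simp: g_def)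
  have m2: "y + r * x + s2 / 2 * G r \<le> b"
    using *[of r 1 b] Q2b by (simp add: G_def algebra_simps)
  have m1: "a + s2 / 2 * G t \<le> y + t * x"
  proof -
    have "- t * x + -1 * y + s2 / 2 * (\<bar>- t * C + -1 * S\<bar> + \<bar>- t * S - -1 * C\<bar>) \<le> - a"
      by (rule *) (use Q2a in force)
    moreover have "\<bar>- t * C + -1 * S\<bar> = \<bar>t * C + S\<bar>" "\<bar>- t * S - -1 * C\<bar> = \<bar>t * S - C\<bar>"
      by linarith+
    ultimately show ?thesis unfolding G_def by simp
  qed
  have G1: "(1 - \<bar>u\<bar>) * g \<le> G u" for u
  proof -
    have "\<bar>S\<bar> - \<bar>u\<bar> * \<bar>C\<bar> \<le> \<bar>u * C + S\<bar>" "\<bar>C\<bar> - \<bar>u\<bar> * \<bar>S\<bar> \<le> \<bar>u * S - C\<bar>"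
      unfolding abs_mult[symmetric] by linarith+
    then show ?thesis by (simp add: g_def G_def algebra_simps)
  qed
  have G2: "2 + 2 * \<bar>u\<bar> \<le> (1 + \<bar>u\<bar>) * g + G u" for u
    unfolding g_def G_def by (rule corner_inequality_abs[OF CS])
  show ?thesis
    by (rule chain_arithmetic[OF \<open>H \<ge> 2\<close> \<open>s2 > 0\<close> s1 s3 bottom top m1 m2 x0 x1 G1 G2 G1 G2])
qed

section \<open>Separation by a line\<close>

lemma convex_square:
  assumes "is_square Q s"
  shows "convex Q"
proof -
  obtain p u v where Q: "Q = {p + a *\<^sub>R u + b *\<^sub>R v | a b. a \<in> {0..s} \<and> b \<in> {0..s}}"
    using assms unfolding is_square_def by blast
  have "Q = (\<lambda>z. p + z) ` (\<lambda>(a, b). a *\<^sub>R u + b *\<^sub>R v) ` ({0..s} \<times> {0..s})"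
    unfolding Q by (force simp: add.assoc)
  moreover have "linear (\<lambda>(a, b). a *\<^sub>R u + b *\<^sub>R v)"
    by (auto intro!: linearI simp: algebra_simps)
  ultimately show ?thesis
    by (metis convex_linear_image convex_translation convex_Times convex_real_interval(5))
qed

lemma interior_square_nonempty:
  assumes "is_square Q s"
  shows "interior Q \<noteq> {}"
proof -
  obtain p u v where "s > 0" and uv: "norm u = 1" "norm v = 1" "inner u v = 0"
    and Q: "Q = {p + a *\<^sub>R u + b *\<^sub>R v | a b. a \<in> {0..s} \<and> b \<in> {0..s}}"
    using assms unfolding is_square_def by blast
  define m where "m = p + (s / 2) *\<^sub>R u + (s / 2) *\<^sub>R v"
  have "ball m (s / 2) \<subseteq> Q"
  proof
    fix z assume "z \<in> ball m (s / 2)"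
    then have d: "norm (z - m) < s / 2" by (simp add: dist_norm norm_minus_commute)
    have bound: "\<bar>inner (z - m) w\<bar> < s / 2" if "norm w = 1" for w
      using Cauchy_Schwarz_ineq2[of "z - m" w] d that by simp
    have expand: "z - m = inner (z - m) u *\<^sub>R u + inner (z - m) v *\<^sub>R v"
    proof -
      obtain d1 d2 u1 u2 v1 v2 where eqs: "z - m = (d1, d2)" "u = (u1, u2)" "v = (v1, v2)"
        by (metis prod.exhaust)
      have "u1\<^sup>2 + u2\<^sup>2 = 1" "v1\<^sup>2 + v2\<^sup>2 = 1" "u1 * v1 + u2 * v2 = 0"
        using uv by (auto simp: eqs norm_Pair inner_Pair)
      then have "d1 = (d1 * u1 + d2 * u2) * u1 + (d1 * v1 + d2 * v2) * v1"
        "d2 = (d1 * u1 + d2 * u2) * u2 + (d1 * v1 + d2 * v2) * v2" by algebra+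
      then show ?thesis by (simp add: eqs inner_Pair)
    qed
    have "z = p + (s / 2 + inner (z - m) u) *\<^sub>R u + (s / 2 + inner (z - m) v) *\<^sub>R v"
      using expand unfolding m_def by (simp add: algebra_simps)
    then show "z \<in> Q" unfolding Q using bound[OF uv(1)] bound[OF uv(2)]
      by (intro CollectI exI[of _ "s / 2 + inner (z - m) u"] exI[of _ "s / 2 + inner (z - m) v"])
        (auto simp: abs_less_iff)
  qed
  then show ?thesis
    using \<open>s > 0\<close> by (metis centre_in_ball empty_iff half_gt_zero interior_maximal open_ball subsetD)
qed

text \<open>
  A separating line exists because squares are convex with nonempty interior. The last alternative is
  that of a vertical line, on whose two sides the squares share the width \<open>1\<close>.
\<close>

lemma separated_squares:
  assumes sq: "is_square P s" "is_square Q s'"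
    and box: "P \<subseteq> {0..1} \<times> X" "Q \<subseteq> {0..1} \<times> X"
    and disj: "interior P \<inter> interior Q = {}"
  shows "lies_below P Q \<or> lies_below Q P \<or> s + s' \<le> 1"
proof -
  obtain n c where "n \<noteq> 0" and P: "\<forall>z \<in> interior P. inner n z \<le> c"
    and Q: "\<forall>z \<in> interior Q. inner n z \<ge> c"
    using separating_hyperplane_sets[of "interior P" "interior Q"] sq disj
    by (metis convex_interior convex_square interior_square_nonempty)
  \<comment> \<open>A square lies in the closure of its interior, so the separation extends to the squares.\<close>
  have subset: "R \<subseteq> closure (interior R)" if "is_square R w" for R w
    using that convex_closure_interior convex_square interior_square_nonempty closure_subset by metis
  have P': "inner n z \<le> c" if "z \<in> P" for z
  proof -
    have "closure (interior P) \<subseteq> {z. inner n z \<le> c}"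
      using P by (intro closure_minimal closed_halfspace_le) auto
    then show ?thesis using subset[OF sq(1)] that by auto
  qed
  have Q': "inner n z \<ge> c" if "z \<in> Q" for z
  proof -
    have "closure (interior Q) \<subseteq> {z. inner n z \<ge> c}"
      using Q by (intro closure_minimal closed_halfspace_ge) auto
    then show ?thesis using subset[OF sq(2)] that by auto
  qed
  obtain n1 n2 where n: "n = (n1, n2)" by fastforce
  have P'': "n1 * x + n2 * y \<le> c" if "(x, y) \<in> P" for x y using P'[OF that] by (simp add: n)
  have Q'': "n1 * x + n2 * y \<ge> c" if "(x, y) \<in> Q" for x y using Q'[OF that] by (simp add: n)
  have slope: "y + n1 / n2 * x = (n1 * x + n2 * y) / n2" if "n2 \<noteq> 0" for x y
    using that by (simp add: field_simps)
  have boxP: "0 \<le> x \<and> x \<le> 1" if "(x, y) \<in> P" for x y using box(1) that by auto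
  have boxQ: "0 \<le> x \<and> x \<le> 1" if "(x, y) \<in> Q" for x y using box(2) that by auto
  consider "n2 > 0" | "n2 < 0" | "n2 = 0" "n1 > 0" | "n2 = 0" "n1 < 0"
    using \<open>n \<noteq> 0\<close> by (fastforce simp: n zero_prod_def)
  then show ?thesis
  proof cases
    case 1
    then have "n2 \<noteq> 0" "n2 \<ge> 0" by auto
    note line = slope[OF this(1)] and mono = divide_right_mono[OF _ this(2)]
    have "y + n1 / n2 * x \<le> c / n2" if "(x, y) \<in> P" for x y
      unfolding line by (rule mono[OF P''[OF that]])
    moreover have "c / n2 \<le> y + n1 / n2 * x" if "(x, y) \<in> Q" for x y
      unfolding line by (rule mono[OF Q''[OF that]])
    ultimately have "lies_below P Q" unfolding lies_below_def by blast
    then show ?thesis by simp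
  next
    case 2
    then have "n2 \<noteq> 0" "n2 \<le> 0" by auto
    note line = slope[OF this(1)] and mono = divide_right_mono_neg[OF _ this(2)]
    have "y + n1 / n2 * x \<le> c / n2" if "(x, y) \<in> Q" for x y
      unfolding line by (rule mono[OF Q''[OF that]])
    moreover have "c / n2 \<le> y + n1 / n2 * x" if "(x, y) \<in> P" for x y
      unfolding line by (rule mono[OF P''[OF that]])
    ultimately have "lies_below Q P" unfolding lies_below_def by blast
    then show ?thesis by simp
  next
    case 3
    have "0 \<le> x \<and> x \<le> c / n1" if "(x, y) \<in> P" for x y
      using P''[OF that] boxP[OF that] 3 by (simp add: pos_le_divide_eq mult.commute)
    then have "s \<le> c / n1 - 0" by (rule square_side_le_horizontal_extent[OF sq(1)])
    moreover have "c / n1 \<le> x \<and> x \<le> 1" if "(x, y) \<in> Q" for x y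
      using Q''[OF that] boxQ[OF that] 3 by (simp add: pos_divide_le_eq mult.commute)
    then have "s' \<le> 1 - c / n1" by (rule square_side_le_horizontal_extent[OF sq(2)])
    ultimately show ?thesis by simp
  next
    case 4
    have "c / n1 \<le> x \<and> x \<le> 1" if "(x, y) \<in> P" for x y
      using P''[OF that] boxP[OF that] 4 by (simp add: neg_divide_le_eq mult.commute)
    then have "s \<le> 1 - c / n1" by (rule square_side_le_horizontal_extent[OF sq(1)])
    moreover have "0 \<le> x \<and> x \<le> c / n1" if "(x, y) \<in> Q" for x y
      using Q''[OF that] boxQ[OF that] 4 by (simp add: neg_le_divide_eq mult.commute)
    then have "s' \<le> c / n1 - 0" by (rule square_side_le_horizontal_extent[OF sq(2)])
    ultimately show ?thesis by simp
  qed
qed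

section \<open>Three squares in a rectangle\<close>

theorem theorem1:
  fixes H :: real
    and Q1 Q2 Q3 :: "(real \<times> real) set"
    and s1 s2 s3 :: real
  assumes "H \<ge> 2"
    and "is_square Q1 s1" and "is_square Q2 s2" and "is_square Q3 s3"
    and "Q1 \<subseteq> {0..1} \<times> {0..H}" and "Q2 \<subseteq> {0..1} \<times> {0..H}" and "Q3 \<subseteq> {0..1} \<times> {0..H}"
    and "interior Q1 \<inter> interior Q2 = {}"
    and "interior Q1 \<inter> interior Q3 = {}"
    and "interior Q2 \<inter> interior Q3 = {}"
  shows "s1 + s2 + s3 \<le> H"
proof -
  note sq = assms(2-4) and box = assms(5-7)
  have le1: "s1 \<le> 1" "s2 \<le> 1" "s3 \<le> 1"
    using sq box by (auto intro: square_side_le_one)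
  note sep = separated_squares[OF sq(1,2) box(1,2) assms(8)]
    separated_squares[OF sq(1,3) box(1,3) assms(9)]
    separated_squares[OF sq(2,3) box(2,3) assms(10)]
  show ?thesis
  proof (cases "s1 + s2 \<le> 1 \<or> s1 + s3 \<le> 1 \<or> s2 + s3 \<le> 1")
    case True
    then show ?thesis using le1 \<open>H \<ge> 2\<close> by linarith
  next
    case False
    then consider "lies_below Q1 Q2" "lies_below Q2 Q3" | "lies_below Q1 Q3" "lies_below Q3 Q2"
      | "lies_below Q2 Q1" "lies_below Q1 Q3" | "lies_below Q2 Q3" "lies_below Q3 Q1"
      | "lies_below Q3 Q1" "lies_below Q1 Q2" | "lies_below Q3 Q2" "lies_below Q2 Q1"
      using sep by blast
    then show ?thesis
      using chain_sum_le[OF \<open>H \<ge> 2\<close> sq(1,2,3) box(1,2,3)] chain_sum_le[OF \<open>H \<ge> 2\<close> sq(1,3,2) box(1,3,2)]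
        chain_sum_le[OF \<open>H \<ge> 2\<close> sq(2,1,3) box(2,1,3)] chain_sum_le[OF \<open>H \<ge> 2\<close> sq(2,3,1) box(2,3,1)]
        chain_sum_le[OF \<open>H \<ge> 2\<close> sq(3,1,2) box(3,1,2)] chain_sum_le[OF \<open>H \<ge> 2\<close> sq(3,2,1) box(3,2,1)]
      by cases linarith+
  qed
qed

end
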